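(* Let $\tau>0$, $\lambda\in[0,1]$, let $\phi_*^{n+\frac12}$ be a given function, and let $(\phi^n,r^n)$ and $(\phi^{n+1},\mu^{n+\frac12},r^{n+1})$ satisfy the second-order weighted SAV-CN scheme $$\frac{\phi^{n+1}-\phi^{n}}{\tau}=-\mathcal{G}\mu^{n+\frac12},$$ $$\mu^{n+\frac12}=\mathcal{L}\frac{\phi^{n+1}+\phi^{n}}{2}+\frac{r^{n+1}+r^{n}}{2\sqrt{\mathcal{E}_{\mathcal N}[\phi_*^{n+\frac12}]+C}}H(\phi_*^{n+\frac12}),$$ $$\lambda(r^{n+1}+r^{n})\frac{r^{n+1}-r^{n}}{\tau}+(1-\lambda)\frac{\mathcal{E}_{\mathcal N}[\phi^{n+1}]-\mathcal{E}_{\mathcal N}[\phi^{n}]}{\tau}=\frac{r^{n+1}+r^{n}}{2\sqrt{\mathcal{E}_{\mathcal N}[\phi_*^{n+\frac12}]+C}}\left(H(\phi_*^{n+\frac12}),\frac{\phi^{n+1}-\phi^{n}}{\tau}\right).$$ Then, unconditionally (with no restriction on $\tau$), $$\frac{\overline{\mathcal{E}}[\phi^{n+1},r^{n+1}]-\overline{\mathcal{E}}[\phi^{n},r^{n}]}{\tau}=-(\mu^{n+\frac12},\mathcal{G}\mu^{n+\frac12})\le 0,$$ where $$\overline{\mathcal{E}}[\phi^{n},r^{n}]=\frac12(\phi^{n},\mathcal{L}\phi^{n})+\lambda\big((r^{n})^{2}-C\big)+(1-\lambda)\mathcal{E}_{\mathcal N}[\phi^{n}].$$ Furthermore, if $(r^{n+1})^{2}-(r^{n})^{2}\ge\mathcal{E}_{\mathcal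 N}[\phi^{n+1}]-\mathcal{E}_{\mathcal N}[\phi^{n}]$, then also $$\frac{\mathcal{E}[\phi^{n+1}]-\mathcal{E}[\phi^{n}]}{\tau}\le-(\mu^{n+\frac12},\mathcal{G}\mu^{n+\frac12})\le 0,\qquad\text{where}\quad \mathcal{E}[\phi^{n}]=\frac12(\phi^{n},\mathcal{L}\phi^{n})+\mathcal{E}_{\mathcal N}[\phi^{n}].$$
   Context: Setting: $(\cdot,\cdot)$ is the $L^2(\Omega)$ inner product on real-valued functions on a domain $\Omega$ (with boundary conditions such that boundary terms in integrations by parts vanish). $\mathcal{L}$ is a linear, symmetric, non-negative operator; $\mathcal{G}$ is a positive linear operator; $\mathcal{E}_{\mathcal N}$ is a bounded nonlinear functional with variational derivative $H(\phi)=\delta\mathcal{E}_{\mathcal N}/\delta\phi$, i.e. $\frac{d}{ds}\mathcal{E}_{\mathcal N}[\phi+s\psi]\big|_{s=0}=(H(\phi),\psi)$; $C$ is a constant such that $\mathcal{E}_{\mathcal N}[\phi]+C>0$ for all $\phi$. $r^n\in\mathbb{R}$ is the numerical approximation at $t^n=n\tau$ of the auxiliary variable $r(t)=\sqrt{\mathcal{E}_{\mathcal N}[\phi(t)]+C}$. The function $\phi_*^{n+\frac12}$ may be any approximation of $\phi(t^{n+\frac12})$ with error $\mathcal{O}(\tau^2)$. *)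

theory Defs
  imports "HOL-Analysis.Analysis"
begin

text \<open>
  Elements of \<open>L\<^sup>2(\<Omega>)\<close> are represented by functions on the ambient Euclidean space, taken up to
  equality almost everywhere on \<open>\<Omega>\<close>; values outside \<open>\<Omega>\<close> are irrelevant.
\<close>

definition L2 :: "'a::euclidean_space set \<Rightarrow> ('a \<Rightarrow> real) set" where
  "L2 \<Omega> = {f \<in> borel_measurable (lebesgue_on \<Omega>). integrable (lebesgue_on \<Omega>) (\<lambda>x. (f x)\<^sup>2)}"

definition L2_inner :: "'a::euclidean_space set \<Rightarrow> ('a \<Rightarrow> real) \<Rightarrow> ('a \<Rightarrow> real) \<Rightarrow> real" where
  "L2_inner \<Omega> f g = (LINT x|lebesgue_on \<Omega>. f x * g x)"

definition L2_eq :: "'a::euclidean_space set \<Rightarrow> ('a \<Rightarrow> real) \<Rightarrow> ('a \<Rightarrow> real) \<Rightarrow> bool" where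
  "L2_eq \<Omega> f g \<longleftrightarrow> (AE x in lebesgue_on \<Omega>. f x = g x)"

text \<open>
  The admissible functions (regularity and boundary conditions) form a linear subspace of \<open>L\<^sup>2(\<Omega>)\<close>.
\<close>

definition L2_subspace :: "'a::euclidean_space set \<Rightarrow> ('a \<Rightarrow> real) set \<Rightarrow> bool" where
  "L2_subspace \<Omega> D \<longleftrightarrow> D \<subseteq> L2 \<Omega> \<and> (\<lambda>x. 0) \<in> D \<and>
     (\<forall>f\<in>D. \<forall>g\<in>D. (\<lambda>x. f x + g x) \<in> D) \<and> (\<forall>c. \<forall>f\<in>D. (\<lambda>x. c * f x) \<in> D)"

text \<open>
  Operators are possibly unbounded: they are given on a domain \<open>D\<close>, which carries the
  boundary conditions that make boundary terms in integrations by parts vanish.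
\<close>

definition linear_operator ::
    "'a::euclidean_space set \<Rightarrow> ('a \<Rightarrow> real) set \<Rightarrow> (('a \<Rightarrow> real) \<Rightarrow> ('a \<Rightarrow> real)) \<Rightarrow> bool" where
  "linear_operator \<Omega> D T \<longleftrightarrow> L2_subspace \<Omega> D \<and> (\<forall>f\<in>D. T f \<in> L2 \<Omega>) \<and>
     (\<forall>f\<in>D. \<forall>g\<in>D. L2_eq \<Omega> (T (\<lambda>x. f x + g x)) (\<lambda>x. T f x + T g x)) \<and>
     (\<forall>c. \<forall>f\<in>D. L2_eq \<Omega> (T (\<lambda>x. c * f x)) (\<lambda>x. c * T f x))"

definition symmetric_operator ::
    "'a::euclidean_space set \<Rightarrow> ('a \<Rightarrow> real) set \<Rightarrow> (('a \<Rightarrow> real) \<Rightarrow> ('a \<Rightarrow> real)) \<Rightarrow> bool" where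
  "symmetric_operator \<Omega> D T \<longleftrightarrow> (\<forall>f\<in>D. \<forall>g\<in>D. L2_inner \<Omega> f (T g) = L2_inner \<Omega> (T f) g)"

text \<open>
  Positivity in the operator-theoretic sense, which does not exclude a kernel (for instance the
  constants, for the negative Laplacian with periodic or Neumann boundary conditions).
\<close>

definition nonneg_operator ::
    "'a::euclidean_space set \<Rightarrow> ('a \<Rightarrow> real) set \<Rightarrow> (('a \<Rightarrow> real) \<Rightarrow> ('a \<Rightarrow> real)) \<Rightarrow> bool" where
  "nonneg_operator \<Omega> D T \<longleftrightarrow> (\<forall>f\<in>D. L2_inner \<Omega> f (T f) \<ge> 0)"

definition variational_derivative ::
    "'a::euclidean_space set \<Rightarrow> ('a \<Rightarrow> real) set \<Rightarrow> (('a \<Rightarrow> real) \<Rightarrow> real) \<Rightarrow>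
     (('a \<Rightarrow> real) \<Rightarrow> ('a \<Rightarrow> real)) \<Rightarrow> bool" where
  "variational_derivative \<Omega> D E H \<longleftrightarrow> L2_subspace \<Omega> D \<and> (\<forall>\<phi>\<in>D. H \<phi> \<in> L2 \<Omega>) \<and>
     (\<forall>\<phi>\<in>D. \<forall>\<psi>\<in>D.
        ((\<lambda>s. E (\<lambda>x. \<phi> x + s * \<psi> x)) has_real_derivative L2_inner \<Omega> (H \<phi>) \<psi>) (at 0))"

text \<open>
  One time step from \<open>(\<phi>, r)\<close> to \<open>(\<phi>', r')\<close>, with chemical potential \<open>\<mu>\<close> and approximation \<open>\<phi>s\<close>
  of the phase variable at the half time level; \<open>\<theta>\<close> is the weight.
\<close>

definition weighted_SAV_CN_step ::
    "'a::euclidean_space set \<Rightarrow> (('a \<Rightarrow> real) \<Rightarrow> ('a \<Rightarrow> real)) \<Rightarrow> (('a \<Rightarrow> real) \<Rightarrow> ('a \<Rightarrow> real)) \<Rightarrow>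
     (('a \<Rightarrow> real) \<Rightarrow> real) \<Rightarrow> (('a \<Rightarrow> real) \<Rightarrow> ('a \<Rightarrow> real)) \<Rightarrow> real \<Rightarrow> real \<Rightarrow> real \<Rightarrow> ('a \<Rightarrow> real) \<Rightarrow>
     ('a \<Rightarrow> real) \<Rightarrow> real \<Rightarrow> ('a \<Rightarrow> real) \<Rightarrow> ('a \<Rightarrow> real) \<Rightarrow> real \<Rightarrow> bool" where
  "weighted_SAV_CN_step \<Omega> L G EN H C \<theta> \<tau> \<phi>s \<phi> r \<phi>' \<mu> r' \<longleftrightarrow>
     L2_eq \<Omega> (\<lambda>x. (\<phi>' x - \<phi> x) / \<tau>) (\<lambda>x. - G \<mu> x) \<and>
     L2_eq \<Omega> \<mu> (\<lambda>x. L (\<lambda>y. (\<phi>' y + \<phi> y) / 2) x + (r' + r) / (2 * sqrt (EN \<phi>s + C)) * H \<phi>s x) \<and>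
     \<theta> * (r' + r) * ((r' - r) / \<tau>) + (1 - \<theta>) * ((EN \<phi>' - EN \<phi>) / \<tau>) =
       (r' + r) / (2 * sqrt (EN \<phi>s + C)) * L2_inner \<Omega> (H \<phi>s) (\<lambda>x. (\<phi>' x - \<phi> x) / \<tau>)"

definition energy ::
    "'a::euclidean_space set \<Rightarrow> (('a \<Rightarrow> real) \<Rightarrow> ('a \<Rightarrow> real)) \<Rightarrow> (('a \<Rightarrow> real) \<Rightarrow> real) \<Rightarrow>
     ('a \<Rightarrow> real) \<Rightarrow> real" where
  "energy \<Omega> L EN \<phi> = 1 / 2 * L2_inner \<Omega> \<phi> (L \<phi>) + EN \<phi>"

definition modified_energy ::
    "'a::euclidean_space set \<Rightarrow> (('a \<Rightarrow> real) \<Rightarrow> ('a \<Rightarrow> real)) \<Rightarrow> (('a \<Rightarrow> real) \<Rightarrow> real) \<Rightarrow> real \<Rightarrow> real \<Rightarrow>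
     ('a \<Rightarrow> real) \<Rightarrow> real \<Rightarrow> real" where
  "modified_energy \<Omega> L EN C \<theta> \<phi> r =
     1 / 2 * L2_inner \<Omega> \<phi> (L \<phi>) + \<theta> * (r\<^sup>2 - C) + (1 - \<theta>) * EN \<phi>"

end

theory Submission
  imports Defs
begin

text \<open>
  The energy law comes from testing the equation for \<open>\<mu>\<close> with the discrete time derivative
  \<open>\<delta> = (\<phi>' - \<phi>) / \<tau>\<close>. By the first equation \<open>\<delta> = - G \<mu>\<close>, so the left-hand side is the dissipation
  \<open>- (\<mu>, G \<mu>)\<close>. On the right-hand side the midpoint rule turns the quadratic part into an exact
  difference, as in \<open>(a - b) (a + b) = a\<^sup>2 - b\<^sup>2\<close>: symmetry of \<open>L\<close> cancels the mixed terms of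
  \<open>(\<delta>, L ((\<phi>' + \<phi>) / 2))\<close> (lemma \<open>symmetric_operator_midpoint\<close>). What remains is the explicit
  nonlinear term, and the third equation of the scheme says precisely that this term is the
  difference quotient of \<open>\<theta> r\<^sup>2 + (1 - \<theta>) E\<^sub>N\<close>. No step discards or estimates anything, so the law
  is an identity for every \<open>\<tau>\<close>; its sign is the positivity of \<open>G\<close>.

  The original energy minus the modified one is \<open>\<theta> (E\<^sub>N - r\<^sup>2 + C)\<close>. Under the additional
  hypothesis this difference cannot grow in the step, so the original energy decays at least as fast
  as the modified one.

  Unbounded operators act on representatives and respect linearity only almost everywhere, so the
  manipulations of inner products rest on bilinearity of \<open>L2_inner\<close> on \<open>L2 \<Omega>\<close> and its invariance
  under \<open>L2_eq\<close>.
\<close>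

lemma L2_measurable: "f \<in> L2 \<Omega> \<Longrightarrow> f \<in> borel_measurable (lebesgue_on \<Omega>)"
  by (simp add: L2_def)

lemma L2_integrable_mult:
  assumes "f \<in> L2 \<Omega>" "g \<in> L2 \<Omega>"
  shows "integrable (lebesgue_on \<Omega>) (\<lambda>x. f x * g x)"
proof (rule Bochner_Integration.integrable_bound)
  show "integrable (lebesgue_on \<Omega>) (\<lambda>x. (f x)\<^sup>2 + (g x)\<^sup>2)"
    using assms by (simp add: L2_def)
  show "(\<lambda>x. f x * g x) \<in> borel_measurable (lebesgue_on \<Omega>)"
    using assms by (intro borel_measurable_times L2_measurable)
  have "\<bar>a * b\<bar> \<le> a\<^sup>2 + b\<^sup>2" for a b :: real
    using sum_squares_bound[of "\<bar>a\<bar>" "\<bar>b\<bar>"] mult_nonneg_nonneg[of "\<bar>a\<bar>" "\<bar>b\<bar>"]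
    unfolding abs_mult power2_abs by linarith
  then show "AE x in lebesgue_on \<Omega>. norm (f x * g x) \<le> norm ((f x)\<^sup>2 + (g x)\<^sup>2)"
    by simp
qed

lemma L2_add:
  assumes "f \<in> L2 \<Omega>" "g \<in> L2 \<Omega>"
  shows "(\<lambda>x. f x + g x) \<in> L2 \<Omega>"
proof -
  have "integrable (lebesgue_on \<Omega>) (\<lambda>x. (f x)\<^sup>2 + (g x)\<^sup>2 + 2 * (f x * g x))"
    using assms L2_integrable_mult[OF assms] by (simp add: L2_def)
  then show ?thesis
    using assms by (auto simp: L2_def power2_sum mult.assoc intro: borel_measurable_add)
qed

lemma L2_scale: "f \<in> L2 \<Omega> \<Longrightarrow> (\<lambda>x. c * f x) \<in> L2 \<Omega>"
  by (auto simp: L2_def power_mult_distrib intro: borel_measurable_times)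

lemma L2_inner_commute: "L2_inner \<Omega> f g = L2_inner \<Omega> g f"
  by (simp add: L2_inner_def mult.commute)

lemma L2_inner_add_left:
  assumes "f \<in> L2 \<Omega>" "g \<in> L2 \<Omega>" "h \<in> L2 \<Omega>"
  shows "L2_inner \<Omega> (\<lambda>x. f x + g x) h = L2_inner \<Omega> f h + L2_inner \<Omega> g h"
  unfolding L2_inner_def distrib_right
  using assms by (intro Bochner_Integration.integral_add L2_integrable_mult)

lemma L2_inner_scale_left: "L2_inner \<Omega> (\<lambda>x. c * f x) h = c * L2_inner \<Omega> f h"
  by (simp add: L2_inner_def mult.assoc)

lemma L2_inner_cong_left:
  assumes "L2_eq \<Omega> f g" "f \<in> L2 \<Omega>" "g \<in> L2 \<Omega>" "h \<in> L2 \<Omega>"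
  shows "L2_inner \<Omega> f h = L2_inner \<Omega> g h"
  unfolding L2_inner_def
proof (rule integral_cong_AE)
  show "AE x in lebesgue_on \<Omega>. f x * h x = g x * h x"
    using assms(1) unfolding L2_eq_def by eventually_elim simp
qed (rule borel_measurable_times; rule L2_measurable; fact)+

lemma L2_subspaceD:
  assumes "L2_subspace \<Omega> D"
  shows "f \<in> D \<Longrightarrow> f \<in> L2 \<Omega>"
    and "f \<in> D \<Longrightarrow> g \<in> D \<Longrightarrow> (\<lambda>x. f x + g x) \<in> D"
    and "f \<in> D \<Longrightarrow> (\<lambda>x. c * f x) \<in> D"
  using assms unfolding L2_subspace_def by auto

text \<open>
  The polarised form of \<open>(a - b) (a + b) / 2 = (a\<^sup>2 - b\<^sup>2) / 2\<close> for the quadratic form of \<open>T\<close>; the mixed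
  terms \<open>(f, T g)\<close> and \<open>(g, T f)\<close> cancel by symmetry.
\<close>

lemma symmetric_operator_midpoint:
  assumes T: "linear_operator \<Omega> D T" "symmetric_operator \<Omega> D T"
    and f: "f \<in> D" and g: "g \<in> D"
  shows "L2_inner \<Omega> (T (\<lambda>x. (f x + g x) / 2)) (\<lambda>x. (f x - g x) / c)
           = (L2_inner \<Omega> f (T f) - L2_inner \<Omega> g (T g)) / (2 * c)"
proof -
  let ?m = "\<lambda>x. 1 / 2 * (f x + g x)" and ?d = "\<lambda>x. 1 / c * (f x + - 1 * g x)"
  have D: "L2_subspace \<Omega> D" and TL2: "\<And>h. h \<in> D \<Longrightarrow> T h \<in> L2 \<Omega>"
    and add: "L2_eq \<Omega> (T (\<lambda>x. f x + g x)) (\<lambda>x. T f x + T g x)"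
    and scale: "\<And>a h. h \<in> D \<Longrightarrow> L2_eq \<Omega> (T (\<lambda>x. a * h x)) (\<lambda>x. a * T h x)"
    using T(1) f g unfolding linear_operator_def by auto
  note sub = L2_subspaceD[OF D]
  have s: "(\<lambda>x. f x + g x) \<in> D"
    using f g by (rule sub)
  have "L2_eq \<Omega> (T ?m) (\<lambda>x. 1 / 2 * T (\<lambda>x. f x + g x) x)"
    by (rule scale[OF s])
  then have Tm: "L2_eq \<Omega> (T ?m) (\<lambda>x. 1 / 2 * (T f x + T g x))"
    using add unfolding L2_eq_def by eventually_elim simp
  have m: "?m \<in> D"
    using s by (rule sub)
  have neg: "(\<lambda>x. - 1 * g x) \<in> D"
    using g by (rule sub)
  have d: "?d \<in> D"
    by (intro sub f neg)
  have expand: "L2_inner \<Omega> ?d h = 1 / c * (L2_inner \<Omega> f h - L2_inner \<Omega> g h)"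
    if "h \<in> L2 \<Omega>" for h
    by (simp only: L2_inner_scale_left
        L2_inner_add_left[OF sub(1)[OF f] sub(1)[OF neg] that]) simp
  have "L2_inner \<Omega> (T ?m) ?d = L2_inner \<Omega> (\<lambda>x. 1 / 2 * (T f x + T g x)) ?d"
    using Tm f g m by (intro L2_inner_cong_left[OF _ _ _ sub(1)[OF d]] L2_scale L2_add TL2)
  also have "\<dots> = 1 / 2 * (L2_inner \<Omega> (T f) ?d + L2_inner \<Omega> (T g) ?d)"
    by (simp only: L2_inner_scale_left
        L2_inner_add_left[OF TL2[OF f] TL2[OF g] sub(1)[OF d]])
  also have "\<dots> = 1 / 2 * (1 / c * (L2_inner \<Omega> f (T f) - L2_inner \<Omega> g (T f))
                 + 1 / c * (L2_inner \<Omega> f (T g) - L2_inner \<Omega> g (T g)))"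
    by (simp only: L2_inner_commute[of \<Omega> "T _" ?d] expand[OF TL2[OF f]] expand[OF TL2[OF g]])
  also have "L2_inner \<Omega> g (T f) = L2_inner \<Omega> f (T g)"
    using T(2) f g unfolding symmetric_operator_def by (metis L2_inner_commute)
  finally show ?thesis
    by (cases "c = 0") (simp_all add: field_simps)
qed

text \<open>
  Both the first and the third equation involve the discrete time derivative \<open>\<delta>\<close>. Testing the
  second one with the same function \<open>\<delta>\<close> therefore lets the first eliminate \<open>\<mu>\<close> on the left and
  the third eliminate \<open>H \<phi>s\<close> on the right.
\<close>

lemma weighted_SAV_CN_energy_identity:
  assumes L: "linear_operator \<Omega> DL L" "symmetric_operator \<Omega> DL L"
    and D: "\<phi> \<in> DL" "\<phi>' \<in> DL"
    and L2: "\<mu> \<in> L2 \<Omega>" "G \<mu> \<in> L2 \<Omega>" "H \<phi>s \<in> L2 \<Omega>"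
    and scheme: "weighted_SAV_CN_step \<Omega> L G EN H C \<theta> \<tau> \<phi>s \<phi> r \<phi>' \<mu> r'"
  shows "(modified_energy \<Omega> L EN C \<theta> \<phi>' r' - modified_energy \<Omega> L EN C \<theta> \<phi> r) / \<tau>
           = - L2_inner \<Omega> \<mu> (G \<mu>)"
proof -
  define \<delta> where "\<delta> = (\<lambda>x. (\<phi>' x - \<phi> x) / \<tau>)"
  define k where "k = (r' + r) / (2 * sqrt (EN \<phi>s + C))"
  let ?Lm = "L (\<lambda>y. (\<phi>' y + \<phi> y) / 2)"
  have time: "L2_eq \<Omega> \<delta> (\<lambda>x. - 1 * G \<mu> x)"
    and potential: "L2_eq \<Omega> \<mu> (\<lambda>x. ?Lm x + k * H \<phi>s x)"
    and auxiliary: "\<theta> * (r' + r) * ((r' - r) / \<tau>) + (1 - \<theta>) * ((EN \<phi>' - EN \<phi>) / \<tau>)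
                      = k * L2_inner \<Omega> (H \<phi>s) \<delta>"
    using scheme unfolding weighted_SAV_CN_step_def \<delta>_def k_def by simp_all
  have DL: "L2_subspace \<Omega> DL"
    using L(1) unfolding linear_operator_def by blast
  note sub = L2_subspaceD[OF DL]
  have "(\<lambda>x. 1 / \<tau> * (\<phi>' x + - 1 * \<phi> x)) \<in> DL"
    by (intro sub D)
  then have \<delta>: "\<delta> \<in> L2 \<Omega>"
    using sub(1) by (simp add: \<delta>_def)
  have "(\<lambda>x. 1 / 2 * (\<phi>' x + \<phi> x)) \<in> DL"
    by (intro sub D)
  then have Lm: "?Lm \<in> L2 \<Omega>"
    using L(1) unfolding linear_operator_def by simp
  have "- L2_inner \<Omega> \<mu> (G \<mu>) = L2_inner \<Omega> (\<lambda>x. - 1 * G \<mu> x) \<mu>"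
    by (simp add: L2_inner_def mult.commute)
  also have "\<dots> = L2_inner \<Omega> \<delta> \<mu>"
    using time \<delta> L2 by (intro L2_inner_cong_left[symmetric] L2_scale)
  also have "\<dots> = L2_inner \<Omega> (\<lambda>x. ?Lm x + k * H \<phi>s x) \<delta>"
    unfolding L2_inner_commute[of \<Omega> \<delta> \<mu>]
    using potential \<delta> Lm L2 by (intro L2_inner_cong_left L2_add L2_scale)
  also have "\<dots> = L2_inner \<Omega> ?Lm \<delta> + k * L2_inner \<Omega> (H \<phi>s) \<delta>"
    by (simp only: L2_inner_add_left[OF Lm L2_scale[OF L2(3)] \<delta>] L2_inner_scale_left)
  also have "L2_inner \<Omega> ?Lm \<delta> = (L2_inner \<Omega> \<phi>' (L \<phi>') - L2_inner \<Omega> \<phi> (L \<phi>)) / (2 * \<tau>)"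
    unfolding \<delta>_def using L D(2,1) by (rule symmetric_operator_midpoint)
  finally show ?thesis
    unfolding auxiliary[symmetric] modified_energy_def
    by (simp add: add_divide_distrib diff_divide_distrib algebra_simps power2_eq_square)
qed

text \<open>The two energies differ by \<open>\<theta> (E\<^sub>N - r\<^sup>2 + C)\<close>, and \<open>E\<^sub>N - r\<^sup>2\<close> does not grow.\<close>

lemma energy_increment_le_modified:
  assumes "0 \<le> \<theta>" and "r'\<^sup>2 - r\<^sup>2 \<ge> EN \<phi>' - EN \<phi>"
  shows "energy \<Omega> L EN \<phi>' - energy \<Omega> L EN \<phi>
           \<le> modified_energy \<Omega> L EN C \<theta> \<phi>' r' - modified_energy \<Omega> L EN C \<theta> \<phi> r"
  using mult_left_mono[OF assms(2,1)]
  by (simp add: energy_def modified_energy_def algebra_simps)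

theorem theorem7:
  fixes \<Omega> :: "'a::euclidean_space set"
    and DL DG DE :: "('a \<Rightarrow> real) set"
    and L G H :: "('a \<Rightarrow> real) \<Rightarrow> ('a \<Rightarrow> real)"
    and EN :: "('a \<Rightarrow> real) \<Rightarrow> real"
    and C \<theta> \<tau> r r' :: real
    and \<phi> \<phi>' \<phi>s \<mu> :: "'a \<Rightarrow> real"
  assumes domain: "open \<Omega>" "connected \<Omega>" "\<Omega> \<noteq> {}"
    and L: "linear_operator \<Omega> DL L" "symmetric_operator \<Omega> DL L" "nonneg_operator \<Omega> DL L"
    and G: "linear_operator \<Omega> DG G" "nonneg_operator \<Omega> DG G"
    and EN_bounded: "bdd_below (EN ` DE)"
    and EN_derivative: "variational_derivative \<Omega> DE EN H"
    and C: "\<forall>\<psi>\<in>DE. EN \<psi> + C > 0"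
    and \<tau>: "\<tau> > 0"
    and \<theta>: "0 \<le> \<theta>" "\<theta> \<le> 1"
    and admissible: "\<phi> \<in> DL \<inter> DE" "\<phi>' \<in> DL \<inter> DE" "\<phi>s \<in> DE" "\<mu> \<in> DG"
    and scheme: "weighted_SAV_CN_step \<Omega> L G EN H C \<theta> \<tau> \<phi>s \<phi> r \<phi>' \<mu> r'"
  shows "(modified_energy \<Omega> L EN C \<theta> \<phi>' r' - modified_energy \<Omega> L EN C \<theta> \<phi> r) / \<tau>
           = - L2_inner \<Omega> \<mu> (G \<mu>)
         \<and> - L2_inner \<Omega> \<mu> (G \<mu>) \<le> 0
         \<and> (r'\<^sup>2 - r\<^sup>2 \<ge> EN \<phi>' - EN \<phi> \<longrightarrow>
             (energy \<Omega> L EN \<phi>' - energy \<Omega> L EN \<phi>) / \<tau> \<le> - L2_inner \<Omega> \<mu> (G \<mu>)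
             \<and> - L2_inner \<Omega> \<mu> (G \<mu>) \<le> 0)"
proof -
  have \<mu>: "\<mu> \<in> L2 \<Omega>" "G \<mu> \<in> L2 \<Omega>" "L2_inner \<Omega> \<mu> (G \<mu>) \<ge> 0"
    using G admissible(4) L2_subspaceD(1)
    unfolding linear_operator_def nonneg_operator_def by blast+
  have "H \<phi>s \<in> L2 \<Omega>"
    using EN_derivative admissible(3) unfolding variational_derivative_def by blast
  with \<mu>(1,2) have identity:
    "(modified_energy \<Omega> L EN C \<theta> \<phi>' r' - modified_energy \<Omega> L EN C \<theta> \<phi> r) / \<tau>
       = - L2_inner \<Omega> \<mu> (G \<mu>)"
    using weighted_SAV_CN_energy_identity[OF L(1,2) _ _ _ _ _ scheme] admissible by blast
  have "(energy \<Omega> L EN \<phi>' - energy \<Omega> L EN \<phi>) / \<tau> \<le> - L2_inner \<Omega> \<mu> (G \<mu>)"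
    if "r'\<^sup>2 - r\<^sup>2 \<ge> EN \<phi>' - EN \<phi>"
    unfolding identity[symmetric]
    using energy_increment_le_modified[where EN = EN, OF \<theta>(1) that] \<tau>
    by (intro divide_right_mono) auto
  with identity \<mu>(3) show ?thesis
    by simp
qed

end
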